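(* Consider the system, constraints, cost functions, sets and Algorithm 1 described in the context, and suppose that: (i) $(A,B)$ is stabilizable, and $K$ is such that $A_K=A+BK$ is Schur stable; (ii) $\mathcal Y\subseteq\mathbb R^p$ is compact, convex and $0\in\operatorname{int}\mathcal Y$; (iii) $\mathcal W\subseteq\mathbb R^o$ is compact, convex, $0\in\operatorname{int}\mathcal W$, and $w_t\in\mathcal W$ for all $t\in\mathbb N$; (iv) there are constants $l_L,\alpha_v,l_v>0$ such that for all $t\in\mathbb N$: $|L_t(u,x)-L_t(\tilde u,\tilde x)|\le l_L\|(u,x)-(\tilde u,\tilde x)\|$ for all $(u,x),(\tilde u,\tilde x)\in\mathcal Z:=\{(u,x)\in\mathbb R^m\times\mathbb R^n: C_ox+Du\in\mathcal Y\}$, and the steady-state cost $L_t^s(v):=L_t(v+KS_Kv,\,S_Kv)$ is $\alpha_v$-strongly convex with $l_v$-Lipschitz continuous gradient on $\mathcal S_v$; (v) the initial reference $r_0\in\overline{\mathcal S}_v$ satisfies $(r_0,x_0-S_Kr_0)\in\mathcal O_\infty^\lambda$. Then there exists $\delta\in(0,1]$ such that the values $\alpha_t$ computed by Algorithm 1 satisfy $\alpha_t\ge\delta$ for all $t\in\mathbb N$.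
   Context: Notation: $\mathbb N$ includes $0$; $\|\cdot\|$ is the Euclidean norm; $\mathcal S\oplus\mathcal T=\{s+t:s\in\mathcal S,t\in\mathcal T\}$; $\mathcal S\ominus\mathcal T=\{s: s+t\in\mathcal S\ \forall t\in\mathcal T\}$; $\Pi_{\mathcal S}(x)=\arg\min_{s\in\mathcal S}\|x-s\|^2$; $\rho(\cdot)$ is the spectral radius; Schur stable means $\rho<1$. System: $x_{t+1}=Ax_t+Bu_t+B_ww_t$, $x_t\in\mathbb R^n$, $u_t\in\mathbb R^m$, $w_t\in\mathbb R^o$, with given initial state $x_0$, constraint output $y_t=C_ox_t+Du_t+D_ww_t\in\mathbb R^p$, and constraints $y_t\in\mathcal Y$ for all $t\in\mathbb N$. The state $x_t$ is measured. Fix $K\in\mathbb R^{m\times n}$ with $A_K:=A+BK$ Schur stable, and put $u_t=v_t+Kx_t$ with virtual reference $v_t\in\mathbb R^m$. With $C:=C_o+DK$ this gives $x_{t+1}=A_Kx_t+Bv_t+B_ww_t$ and $y_t=Cx_t+Dv_t+D_ww_t$. Let $S_K:=(I_n-A_K)^{-1}B$ and $\mathcal S_v:=\{v\in\mathbb R^m:(CS_K+D)v\in\mathcal Y\ominus D_w\mathcal W\}$. Cost functions: $L_t:\mathbb R^m\times\mathbb R^n\to\mathbb R$, with arguments (input, state), are time-varying; at time $t$ only $L_0,\dots,L_{t-1}$ are known. Maximal output admissible set: fix $\lambda$ with $\rho(A_K)<\lambda<1$. $\mathcal O_\infty^\lambda$ is the set of all $(v,\epsilon)\in\mathbb R^m\times\mathbb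 R^n$ such that, with $\epsilon_0=\epsilon$ and $\epsilon_{t+1}=\frac1\lambda(A_K\epsilon_t+B_w\omega_t)$, one has $C\epsilon_t+(CS_K+D)v+D_w\omega_t\in\mathcal Y$ for all $t\in\mathbb N$ and all sequences $\omega_t\in\mathcal W$. Constraint tightening: $\mathcal P^\lambda\subseteq\mathbb R^n$ is a robust positively invariant set for $\epsilon_{t+1}=\frac1\lambda(A_K\epsilon_t+B_w\omega_t)$, $\omega_t\in\mathcal W$, i.e. $\frac1\lambda A_K\mathcal P^\lambda\oplus\frac1\lambda B_w\mathcal W\subseteq\mathcal P^\lambda$, containing the minimal such set: $\mathcal P^\lambda_\infty:=\bigoplus_{i=0}^\infty\left(\left(\frac1\lambda A_K\right)^i\frac1\lambda B_w\mathcal W\right)\subseteq\mathcal P^\lambda$. $\overline{\mathcal Y}$ is a convex, compact set with $0\in\overline{\mathcal Y}\subseteq\operatorname{int}\mathcal Y$. The tightened reference set is $\overline{\mathcal S}_v:=\{v\in\mathbb R^m:(CS_K+D)v\in\overline{\mathcal Y}\ominus D_w\mathcal W\ominus C\mathcal P^\lambda\}$. Algorithm 1 (robust OCO-RG scheme) with step size $\gamma\in(0,\frac{2}{\alpha_v+l_v}]$: at $t=0$ set $\alpha_0=1$, $v_0=r_0$, and apply $u_0=v_0+Kx_0$. At each $t\ge1$, given $x_t$: [S1] $r_t=\Pi_{\overline{\mathcal S}_v}\left(r_{t-1}-\gamma\nabla L^s_{t-1}(r_{t-1})\right)$; [S2] $\alpha_t$ is the maximal $\alpha\in[0,1]$ such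 that $v:=v_{t-1}+\alpha(r_t-v_{t-1})$ satisfies $(v,x_t-S_Kv)\in\mathcal O_\infty^\lambda$, and $v_t=v_{t-1}+\alpha_t(r_t-v_{t-1})$; [S3] apply $u_t=v_t+Kx_t$. *)

theory Defs
  imports "HOL-Analysis.Analysis"
begin

definition eigenvalues :: "real^'n^'n \<Rightarrow> complex set" where
  "eigenvalues M = {z. \<exists>q. q \<noteq> 0 \<and> (\<chi> i j. complex_of_real (M $ i $ j)) *v q = z *s q}"

definition spectral_radius :: "real^'n^'n \<Rightarrow> real" where
  "spectral_radius M = Sup (cmod ` eigenvalues M)"

definition schur_stable :: "real^'n^'n \<Rightarrow> bool" where
  "schur_stable M \<longleftrightarrow> spectral_radius M < 1"

definition stabilizable :: "real^'n^'n \<Rightarrow> real^'m^'n \<Rightarrow> bool" where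
  "stabilizable A B \<longleftrightarrow> (\<exists>F :: real^'n^'m. schur_stable (A + B ** F))"

text \<open>Minkowski sums are written with the library's \<open>+\<close> on sets.\<close>

definition pontryagin_diff :: "'a::plus set \<Rightarrow> 'a set \<Rightarrow> 'a set" (infixl \<open>\<ominus>\<close> 65) where
  "S \<ominus> T = {s. \<forall>t\<in>T. s + t \<in> S}"

definition strongly_convex_on :: "'a::real_normed_vector set \<Rightarrow> real \<Rightarrow> ('a \<Rightarrow> real) \<Rightarrow> bool" where
  "strongly_convex_on S \<mu> f \<longleftrightarrow>
     (\<forall>a\<in>S. \<forall>b\<in>S. \<forall>\<theta>\<in>{0..1}.
        f (\<theta> *\<^sub>R a + (1 - \<theta>) *\<^sub>R b)
          \<le> \<theta> * f a + (1 - \<theta>) * f b - \<mu> / 2 * \<theta> * (1 - \<theta>) * (norm (a - b))\<^sup>2)"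

text \<open>Meaningful only at points where \<open>f\<close> has a gradient.\<close>

definition gradient :: "('a::real_inner \<Rightarrow> real) \<Rightarrow> 'a \<Rightarrow> 'a" where
  "gradient f a = (THE g. GDERIV f a :> g)"

definition lipschitz_gradient_on :: "'a::real_inner set \<Rightarrow> real \<Rightarrow> ('a \<Rightarrow> real) \<Rightarrow> bool" where
  "lipschitz_gradient_on S l f \<longleftrightarrow>
     (\<forall>a\<in>S. \<exists>g. GDERIV f a :> g) \<and> l-lipschitz_on S (gradient f)"

text \<open>In what follows \<open>M\<close> plays the role of the closed-loop matrix, and \<open>G\<close> that of
  the steady-state gain from the reference to the constraint output.\<close>

primrec error_seq ::
  "real \<Rightarrow> real^'n^'n \<Rightarrow> real^'o^'n \<Rightarrow> (nat \<Rightarrow> real^'o) \<Rightarrow> real^'n \<Rightarrow> nat \<Rightarrow> real^'n" where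
  "error_seq lam M Bw \<omega> \<epsilon> 0 = \<epsilon>"
| "error_seq lam M Bw \<omega> \<epsilon> (Suc t) =
     (1 / lam) *\<^sub>R (M *v error_seq lam M Bw \<omega> \<epsilon> t + Bw *v \<omega> t)"

definition max_output_admissible ::
  "real \<Rightarrow> real^'n^'n \<Rightarrow> real^'o^'n \<Rightarrow> real^'n^'p \<Rightarrow> real^'m^'p \<Rightarrow> real^'o^'p
    \<Rightarrow> (real^'p) set \<Rightarrow> (real^'o) set \<Rightarrow> ((real^'m) \<times> (real^'n)) set" where
  "max_output_admissible lam M Bw C G Dw Y W =
     {(v, \<epsilon>). \<forall>\<omega>. (\<forall>t. \<omega> t \<in> W) \<longrightarrow>
        (\<forall>t. C *v error_seq lam M Bw \<omega> \<epsilon> t + G *v v + Dw *v \<omega> t \<in> Y)}"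

definition robust_pos_invariant ::
  "real \<Rightarrow> real^'n^'n \<Rightarrow> real^'o^'n \<Rightarrow> (real^'o) set \<Rightarrow> (real^'n) set \<Rightarrow> bool" where
  "robust_pos_invariant lam M Bw W P \<longleftrightarrow>
     (\<lambda>\<epsilon>. (1 / lam) *\<^sub>R (M *v \<epsilon>)) ` P + (\<lambda>\<omega>. (1 / lam) *\<^sub>R (Bw *v \<omega>)) ` W \<subseteq> P"

text \<open>The infinite Minkowski sum of the sets \<open>(M / lam)\<^sup>i (Bw / lam) W\<close>, i.e. the set of all
  values of convergent series with one summand from each set. The matrix power is written
  as an iterated map because \<open>*\<close> on \<open>real^'n^'n\<close> is componentwise.\<close>

definition min_robust_invariant ::
  "real \<Rightarrow> real^'n^'n \<Rightarrow> real^'o^'n \<Rightarrow> (real^'o) set \<Rightarrow> (real^'n) set" where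
  "min_robust_invariant lam M Bw W =
     {s. \<exists>\<omega>. (\<forall>i. \<omega> i \<in> W) \<and>
        (\<lambda>i. ((\<lambda>\<epsilon>. (1 / lam) *\<^sub>R (M *v \<epsilon>)) ^^ i) ((1 / lam) *\<^sub>R (Bw *v \<omega> i))) sums s}"

definition steady_state_cost ::
  "real^'n^'m \<Rightarrow> real^'m^'n \<Rightarrow> ((real^'m) \<times> (real^'n) \<Rightarrow> real) \<Rightarrow> real^'m \<Rightarrow> real" where
  "steady_state_cost K S l v = l (v + K *v (S *v v), S *v v)"

text \<open>The signals \<open>r\<close>, \<open>\<alpha>\<close>, \<open>v\<close>, \<open>u\<close> produced by the scheme along a measured state
  sequence \<open>x\<close>. The argument \<open>Ls\<close> is the sequence of steady-state costs, \<open>Sbar\<close> the tightened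
  reference set and \<open>Oinf\<close> the admissible set.\<close>

definition oco_rg_scheme ::
  "real \<Rightarrow> (nat \<Rightarrow> real^'m \<Rightarrow> real) \<Rightarrow> (real^'m) set \<Rightarrow> ((real^'m) \<times> (real^'n)) set
    \<Rightarrow> real^'m^'n \<Rightarrow> real^'n^'m \<Rightarrow> real^'m \<Rightarrow> (nat \<Rightarrow> real^'n)
    \<Rightarrow> (nat \<Rightarrow> real^'m) \<Rightarrow> (nat \<Rightarrow> real) \<Rightarrow> (nat \<Rightarrow> real^'m) \<Rightarrow> (nat \<Rightarrow> real^'m) \<Rightarrow> bool" where
  "oco_rg_scheme \<gamma> Ls Sbar Oinf S K r0 x r \<alpha> v u \<longleftrightarrow>
     r 0 = r0 \<and> \<alpha> 0 = 1 \<and> v 0 = r0 \<and>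
     (\<forall>t. r (Suc t) = closest_point Sbar (r t - \<gamma> *\<^sub>R gradient (Ls t) (r t))) \<and>
     (\<forall>t. \<alpha> (Suc t) = (GREATEST a. a \<in> {0..1} \<and>
        (let v' = v t + a *\<^sub>R (r (Suc t) - v t) in (v', x (Suc t) - S *v v') \<in> Oinf))) \<and>
     (\<forall>t. v (Suc t) = v t + \<alpha> (Suc t) *\<^sub>R (r (Suc t) - v t)) \<and>
     (\<forall>t. u t = v t + K *v x t)"

end

theory Submission
  imports Defs "HOL-Computational_Algebra.Fundamental_Theorem_Algebra"
begin

text \<open>Fix \<open>v\<close>, \<open>r\<close> in the tightened reference set and an admissible pair \<open>(v, \<epsilon>)\<close>. Admissibility
  for the \<open>1 / \<lambda>\<close>-inflated dynamics passes to \<open>(v, \<epsilon>\<^sup>+ / \<lambda>)\<close>, where \<open>\<epsilon>\<^sup>+\<close> is the true next error.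
  Since the tightened output set lies in the interior of \<open>Y\<close> and the powers of \<open>A\<^sub>K / \<lambda>\<close> are
  bounded, there is \<open>e > 0\<close> such that \<open>(v', d)\<close> is admissible for all tightened \<open>v'\<close> and all
  \<open>d\<close> of norm at most \<open>e\<close>. With \<open>\<delta> = (1 - \<lambda>) s\<close>, the convex combination
  \<open>\<lambda> (v, \<epsilon>\<^sup>+ / \<lambda>) + (1 - \<lambda>) (v + s (r - v), - s S\<^sub>K (r - v))\<close> is exactly the pair reached by the
  step \<open>\<alpha> = \<delta>\<close>. A uniform \<open>s\<close> works because a function that is both Lipschitz and strongly
  convex on a convex set forces that set to be bounded.\<close>

subsection \<open>Polynomials annihilating a vector\<close>

definition complexify :: "real^'n^'n \<Rightarrow> complex^'n^'n" where
  "complexify M = (\<chi> i j. complex_of_real (M $ i $ j))"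

text \<open>Horner's scheme for p(N) q, run on vectors because \<open>*\<close> on matrices is
  componentwise and does not yield matrix powers.\<close>

definition poly_mat_vec :: "complex poly \<Rightarrow> complex^'n^'n \<Rightarrow> complex^'n \<Rightarrow> complex^'n" where
  "poly_mat_vec p N = fold_coeffs (\<lambda>a f q. a *s q + N *v f q) p (\<lambda>q. 0)"

lemma poly_mat_vec_0 [simp]: "poly_mat_vec 0 N q = 0"
  by (simp add: poly_mat_vec_def)

lemma poly_mat_vec_pCons [simp]:
  "poly_mat_vec (pCons a p) N q = a *s q + N *v poly_mat_vec p N q"
  by (cases "p = 0 \<and> a = 0") (auto simp: poly_mat_vec_def vec_eq_iff)

lemma poly_mat_vec_add:
  "poly_mat_vec (p + p') N q = poly_mat_vec p N q + poly_mat_vec p' N q"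
  by (induction p p' rule: poly_induct2)
    (simp_all add: matrix_vector_right_distrib vec.scale_left_distrib algebra_simps)

lemma poly_mat_vec_smult: "poly_mat_vec (smult c p) N q = c *s poly_mat_vec p N q"
  by (induction p) (simp_all add: vec.scale_right_distrib vector_scalar_commute)

lemma poly_mat_vec_sum:
  "poly_mat_vec (\<Sum>i\<in>I. f i) N q = (\<Sum>i\<in>I. poly_mat_vec (f i) N q)"
  by (induction I rule: infinite_finite_induct) (simp_all add: poly_mat_vec_add)

lemma poly_mat_vec_monom: "poly_mat_vec (monom c k) N q = c *s ((*v) N ^^ k) q"
  by (induction k) (simp_all add: monom_0 monom_Suc vector_scalar_commute)

text \<open>Polynomials in N commute with N, which moves a factor N - z from the polynomial onto the
  vector: if (N - z) p'(N) q = 0, then p' annihilates (N - z) q.\<close>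

lemma poly_mat_vec_commute:
  "poly_mat_vec p N (N *v q - z *s q) = N *v poly_mat_vec p N q - z *s poly_mat_vec p N q"
  by (induction p) (simp_all add: matrix_vector_mult_diff_distrib matrix_vector_right_distrib
     vec.scale_right_distrib vec.scale_right_diff_distrib vector_scalar_commute mult.commute)

lemma poly_mat_vec_linear_factor:
  "poly_mat_vec ([:-z, 1:] * p) N q = N *v poly_mat_vec p N q - z *s poly_mat_vec p N q"
proof -
  have "[:-z, 1:] * p = smult (-z) p + pCons 0 p" by simp
  then show ?thesis
    by (simp only: poly_mat_vec_add poly_mat_vec_smult) simp
qed

lemma of_real_smult: "complex_of_real a *s q = a *\<^sub>R q"
  unfolding vec_eq_iff vector_smult_component vector_scaleR_component
  by (simp add: scaleR_conv_of_real)

text \<open>The iterates q, N q, ... live in a finite-dimensional space, so one of them depends on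
  its predecessors. Dependence is taken over the reals, hence the coefficients are embedded by
  \<open>complex_of_real\<close>.\<close>

lemma exists_annihilating_poly:
  fixes N :: "complex^'n^'n"
  obtains p where "p \<noteq> 0" "poly_mat_vec p N q = 0"
proof -
  define f where "f k = ((*v) N ^^ k) q" for k
  have span: "\<exists>u. y = (\<Sum>i<k. u i *\<^sub>R f i)" if "y \<in> span (f ` {..<k})" for y k
    using that
  proof (induction k arbitrary: y)
    case (Suc k)
    then obtain a where "y - a *\<^sub>R f k \<in> span (f ` {..<k})"
      by (auto simp: lessThan_Suc span_breakdown_eq)
    with Suc.IH obtain u where "y - a *\<^sub>R f k = (\<Sum>i<k. u i *\<^sub>R f i)" by blast
    then have "y = (\<Sum>i<Suc k. (u(k := a)) i *\<^sub>R f i)"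
      by (simp add: algebra_simps)
    then show ?case by blast
  qed auto
  have "\<exists>k. f k \<in> span (f ` {..<k})"
  proof (rule ccontr)
    assume neg: "\<not> ?thesis"
    \<comment> \<open>The cardinality is carried along so that k distinct independent vectors
      contradict the dimension bound for large k.\<close>
    have "independent (f ` {..<k}) \<and> card (f ` {..<k}) = k" for k
    proof (induction k)
      case 0
      show ?case by (simp add: independent_empty)
    next
      case (Suc k)
      have k: "f k \<notin> span (f ` {..<k})" using neg by blast
      then have notin: "f k \<notin> f ` {..<k}" using span_base by (rule contrapos_nn)
      have "independent (insert (f k) (f ` {..<k}))"
        using Suc k by (intro independent_insertI) simp_all
      moreover have "card (insert (f k) (f ` {..<k})) = Suc k"
        using Suc notin by simp
      ultimately show ?case unfolding lessThan_Suc image_insert by (rule conjI)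
    qed
    then have "k \<le> DIM(complex^'n)" for k
      using independent_bound by metis
    then show False using not_less_eq_eq by blast
  qed
  then obtain k u where k: "f k = (\<Sum>i<k. u i *\<^sub>R f i)" using span by blast
  define p where "p = monom 1 k + (\<Sum>i<k. monom (- complex_of_real (u i)) i)"
  \<comment> \<open>The sum contributes only below degree k, so p is monic.\<close>
  have "coeff p k = 1" by (simp add: p_def coeff_sum)
  then have "p \<noteq> 0" by auto
  moreover have "poly_mat_vec p N q = f k - (\<Sum>i<k. u i *\<^sub>R f i)"
    unfolding p_def poly_mat_vec_add poly_mat_vec_sum poly_mat_vec_monom f_def[symmetric]
    by (simp add: of_real_smult sum_negf)
  ultimately show thesis using that k by simp
qed

text \<open>Splitting a linear factor off an annihilating polynomial of \<open>q\<close>: if its root \<open>z\<close> is not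
  an eigenvalue, the remaining factor already annihilates \<open>q\<close>; otherwise it annihilates
  \<open>(N - z) q\<close>. This replaces the Jordan normal form.\<close>

lemma annihilating_poly_induct [consumes 2, case_names zero eigenvalue]:
  fixes N :: "complex^'n^'n"
  assumes "p \<noteq> 0" and "poly_mat_vec p N q = 0"
    and zero: "Q 0"
    and step: "\<And>q z y. y \<noteq> 0 \<Longrightarrow> N *v y = z *s y \<Longrightarrow> Q (N *v q - z *s q) \<Longrightarrow> Q q"
  shows "Q q"
  using assms(1,2)
proof (induction "degree p" arbitrary: p q)
  case 0
  then obtain a where "p = [:a:]" "a \<noteq> 0" by (metis degree_eq_zeroE pCons_eq_0_iff)
  with 0 have "q = 0" by (simp add: vec_eq_iff)
  then show ?case using zero by simp
next
  case (Suc d)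
  then have "\<not> constant (poly p)" by (simp add: constant_degree)
  then obtain z where "poly p z = 0" using fundamental_theorem_of_algebra by blast
  then obtain p' where p: "p = [:-z, 1:] * p'" by (auto simp: poly_eq_0_iff_dvd)
  with Suc have p': "p' \<noteq> 0" by auto
  then have deg: "d = degree p'" using Suc.hyps(2) unfolding p
    by (subst (asm) degree_mult_eq) auto
  let ?y = "poly_mat_vec p' N q"
  have *: "N *v ?y - z *s ?y = 0"
    using Suc.prems(2) unfolding p poly_mat_vec_linear_factor .
  show ?case
  proof (cases "?y = 0")
    case True
    then show ?thesis using Suc.hyps(1)[OF deg p'] by blast
  next
    case False
    have "Q (N *v q - z *s q)"
      using Suc.hyps(1)[OF deg p'] * by (simp add: poly_mat_vec_commute)
    moreover have "N *v ?y = z *s ?y" using * by simp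
    ultimately show ?thesis using step False by blast
  qed
qed

subsection \<open>Spectral radius and bounds on matrix powers\<close>

lemma norm_vector_smult: "norm (z *s q) = cmod z * norm q"
  by (simp add: norm_vec_def norm_mult L2_set_right_distrib)

lemma linear_funpow:
  fixes f :: "'a::real_vector \<Rightarrow> 'a"
  assumes "linear f"
  shows "linear (f ^^ k)"
proof (induction k)
  case (Suc k)
  then show ?case using linear_compose[of "f ^^ k" f] assms by (simp add: o_def)
qed (simp add: linear_iff)

text \<open>The orbit of q satisfies a scalar recurrence with factor z, forced by the orbit of (N -
  z) q, which is already bounded by induction. The strict gap between \<open>cmod z\<close> and
  \<open>l\<close> absorbs the forcing without polynomial factors in t.\<close>

lemma complex_orbit_bound:
  fixes N :: "complex^'n^'n"
  assumes l: "l > 0" and ev: "\<And>z q. q \<noteq> 0 \<Longrightarrow> N *v q = z *s q \<Longrightarrow> cmod z < l"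
  shows "\<exists>c. \<forall>t. norm (((*v) N ^^ t) q) \<le> c * l ^ t"
proof -
  obtain p where "p \<noteq> 0" "poly_mat_vec p N q = 0" using exists_annihilating_poly .
  then show ?thesis
  proof (induction rule: annihilating_poly_induct)
    case zero
    have "((*v) N ^^ t) 0 = 0" for t by (induction t) simp_all
    then show ?case by (intro exI[of _ 0]) simp
  next
    case (eigenvalue q z y)
    then obtain c where c: "\<And>t. norm (((*v) N ^^ t) (N *v q - z *s q)) \<le> c * l ^ t" by blast
    have z: "cmod z < l" using ev eigenvalue by blast
    have orbit: "((*v) N ^^ Suc t) q = z *s ((*v) N ^^ t) q + ((*v) N ^^ t) (N *v q - z *s q)" for t
    proof -
      have "((*v) N ^^ t) (z *s q) = z *s ((*v) N ^^ t) q"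
        by (induction t) (simp_all add: vector_scalar_commute)
      then show ?thesis
        using linear_diff[OF linear_funpow[OF matrix_vector_mul_linear, of t N], of "N *v q" "z *s q"]
        by (simp add: funpow_swap1)
    qed
    \<comment> \<open>The first entry covers t = 0; the second gives
      \<open>cmod z * c' + c \<le> c' * l\<close>, which closes the induction on t.\<close>
    define c' where "c' = max (norm q) (c / (l - cmod z))"
    have c': "c \<le> c' * (l - cmod z)"
      using z pos_divide_le_eq[of "l - cmod z" c c'] by (simp add: c'_def)
    have "norm (((*v) N ^^ t) q) \<le> c' * l ^ t" for t
    proof (induction t)
      case (Suc t)
      have "norm (((*v) N ^^ Suc t) q) \<le> cmod z * norm (((*v) N ^^ t) q) + c * l ^ t"
        unfolding orbit using c norm_triangle_le norm_vector_smult
        by (metis add_left_mono)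
      also have "\<dots> \<le> cmod z * (c' * l ^ t) + c' * (l - cmod z) * l ^ t"
        using Suc c' l by (intro add_mono mult_left_mono mult_right_mono) auto
      also have "\<dots> = c' * l ^ Suc t" by (simp add: algebra_simps)
      finally show ?case .
    qed (simp add: c'_def)
    then show ?case by blast
  qed
qed

lemma eigenvalues_complexify:
  "eigenvalues M = {z. \<exists>q. q \<noteq> 0 \<and> complexify M *v q = z *s q}"
  unfolding eigenvalues_def complexify_def ..

text \<open>If no eigenvector existed, the induction over annihilating polynomials would only ever
  reach the zero vector. Existence matters because \<open>spectral_radius\<close> is a
  \<open>Sup\<close>, which says nothing useful on an empty set.\<close>

lemma exists_eigenvector:
  fixes N :: "complex^'n^'n"
  shows "\<exists>z y. y \<noteq> 0 \<and> N *v y = z *s y"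
proof -
  have *: "q = 0 \<or> (\<exists>z y. y \<noteq> 0 \<and> N *v y = z *s y)" for q :: "complex^'n"
  proof -
    obtain p where "p \<noteq> 0" "poly_mat_vec p N q = 0" using exists_annihilating_poly .
    then show ?thesis
    proof (induction rule: annihilating_poly_induct)
      case (eigenvalue q z y)
      from eigenvalue(1,2) have "\<exists>z y. y \<noteq> 0 \<and> N *v y = z *s y" by (intro exI conjI)
      then show ?case by (rule disjI2)
    qed simp
  qed
  have "(1 :: complex^'n) \<noteq> 0" by (simp add: vec_eq_iff)
  with *[of 1] show ?thesis by (elim disjE) (erule notE, assumption+)
qed

lemma eigenvalues_nonempty: "eigenvalues M \<noteq> {}"
  using exists_eigenvector[of "complexify M"]
  by (simp only: eigenvalues_complexify Collect_empty_eq not_all not_not)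

text \<open>Every eigenvalue is bounded in modulus by an operator bound of the matrix; this makes
  the \<open>Sup\<close> an actual upper bound.\<close>

lemma bdd_above_eigenvalues: "bdd_above (cmod ` eigenvalues M)"
proof -
  obtain B where B: "\<And>q. norm (complexify M *v q) \<le> B * norm q"
    using linear_bounded[OF matrix_vector_mul_linear] by blast
  show ?thesis
  proof (rule bdd_aboveI2)
    fix z assume "z \<in> eigenvalues M"
    then have "\<exists>q. q \<noteq> 0 \<and> complexify M *v q = z *s q"
      by (simp only: eigenvalues_complexify mem_Collect_eq)
    then obtain q where q: "q \<noteq> 0" "complexify M *v q = z *s q" by (elim exE conjE)
    have "cmod z * norm q \<le> B * norm q"
      using B[of q] by (simp only: q norm_vector_smult)
    moreover have "norm q > 0" using q(1) by (simp only: zero_less_norm_iff not_False_eq_True)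
    ultimately show "cmod z \<le> B" by (rule mult_right_le_imp_le)
  qed
qed

lemma cmod_le_spectral_radius: "z \<in> eigenvalues M \<Longrightarrow> cmod z \<le> spectral_radius M"
  unfolding spectral_radius_def using bdd_above_eigenvalues by (intro cSup_upper) auto

lemma spectral_radius_nonneg: "0 \<le> spectral_radius M"
  using cmod_le_spectral_radius eigenvalues_nonempty norm_ge_zero order_trans by (metis all_not_in_conv)

lemma complexify_mult_vec:
  "complexify M *v (\<chi> i. complex_of_real (q $ i)) = (\<chi> i. complex_of_real ((M *v q) $ i))"
  by (simp add: complexify_def matrix_vector_mult_def vec_eq_iff)

text \<open>Embedding real vectors into complex ones preserves norms and commutes with the matrix,
  so the complex bound transfers.\<close>

lemma real_orbit_bound:
  fixes M :: "real^'n^'n"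
  assumes "spectral_radius M < l"
  shows "\<exists>c. \<forall>t. norm (((*v) M ^^ t) q) \<le> c * l ^ t"
proof -
  let ?q = "\<chi> i. complex_of_real (q $ i)"
  have "((*v) (complexify M) ^^ t) ?q = (\<chi> i. complex_of_real (((*v) M ^^ t) q $ i))" for t
    by (induction t) (simp_all add: complexify_mult_vec)
  then have "norm (((*v) (complexify M) ^^ t) ?q) = norm (((*v) M ^^ t) q)" for t
    by (simp add: norm_vec_def)
  moreover have "\<exists>c. \<forall>t. norm (((*v) (complexify M) ^^ t) ?q) \<le> c * l ^ t"
  proof (rule complex_orbit_bound)
    show "l > 0" using assms spectral_radius_nonneg[of M] by linarith
    show "cmod z < l" if "q \<noteq> 0" "complexify M *v q = z *s q" for z q
      using cmod_le_spectral_radius[of z M] assms that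
      unfolding eigenvalues_complexify by force
  qed
  ultimately show ?thesis by simp
qed

text \<open>Orbit bounds have constants depending on the vector; expanding in the finite basis makes
  the constant uniform.\<close>

lemma matrix_power_bound:
  fixes M :: "real^'n^'n"
  assumes "spectral_radius M < l"
  obtains c where "c > 0" "\<And>t q. norm (((*v) M ^^ t) q) \<le> c * l ^ t * norm q"
proof -
  have l: "l > 0" using assms spectral_radius_nonneg[of M] by linarith
  have "\<forall>b. \<exists>c. \<forall>t. norm (((*v) M ^^ t) b) \<le> c * l ^ t"
    using real_orbit_bound[OF assms] by (rule allI)
  then obtain c where "\<forall>b t. norm (((*v) M ^^ t) b) \<le> c b * l ^ t"
    unfolding choice_iff by (elim exE)
  then have c: "norm (((*v) M ^^ t) b) \<le> c b * l ^ t" for b t by (elim allE)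
  have c0: "0 \<le> c b" for b using order_trans[OF norm_ge_zero c[of 0 b]] by simp
  show thesis
  proof (rule that)
    \<comment> \<open>Adding 1 makes the constant strictly positive, so that it can later be divided
      by.\<close>
    show "0 < (\<Sum>b\<in>Basis. c b) + 1" using c0 by (simp add: sum_nonneg add_nonneg_pos)
    fix t and q :: "real^'n"
    have lin: "linear ((*v) M ^^ t)" by (simp add: linear_funpow)
    have "norm (((*v) M ^^ t) q) = norm (((*v) M ^^ t) (\<Sum>b\<in>Basis. (q \<bullet> b) *\<^sub>R b))"
      by (simp add: euclidean_representation)
    also have "\<dots> = norm (\<Sum>b\<in>Basis. (q \<bullet> b) *\<^sub>R ((*v) M ^^ t) b)"
      using linear_sum[OF lin, of "\<lambda>b. (q \<bullet> b) *\<^sub>R b" Basis] linear_cmul[OF lin] by simp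
    also have "\<dots> \<le> (\<Sum>b\<in>Basis. norm q * (c b * l ^ t))"
      by (intro sum_norm_le) (auto intro!: mult_mono c Basis_le_norm)
    also have "\<dots> = (\<Sum>b\<in>Basis. c b) * l ^ t * norm q"
      by (simp add: sum_distrib_left sum_distrib_right mult_ac)
    also have "\<dots> \<le> ((\<Sum>b\<in>Basis. c b) + 1) * l ^ t * norm q"
      using l by (intro mult_right_mono) auto
    finally show "norm (((*v) M ^^ t) q) \<le> ((\<Sum>b\<in>Basis. c b) + 1) * l ^ t * norm q" .
  qed
qed

subsection \<open>The maximal output admissible set\<close>

text \<open>The recursion is affine in the error; since the weights sum to one, the common
  disturbance term splits as well.\<close>

lemma error_seq_convex:
  assumes "a + b = 1"
  shows "error_seq lam M Bw \<omega> (a *\<^sub>R \<epsilon> + b *\<^sub>R \<epsilon>') t =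
    a *\<^sub>R error_seq lam M Bw \<omega> \<epsilon> t + b *\<^sub>R error_seq lam M Bw \<omega> \<epsilon>' t"
proof (induction t)
  case (Suc t)
  have b: "b = 1 - a" using assms by simp
  have "M *v error_seq lam M Bw \<omega> (a *\<^sub>R \<epsilon> + b *\<^sub>R \<epsilon>') t + Bw *v \<omega> t =
      a *\<^sub>R (M *v error_seq lam M Bw \<omega> \<epsilon> t + Bw *v \<omega> t) +
      b *\<^sub>R (M *v error_seq lam M Bw \<omega> \<epsilon>' t + Bw *v \<omega> t)"
    unfolding Suc by (simp add: b algebra_simps)
  then show ?case
    unfolding error_seq.simps by (simp only: scaleR_right_distrib scaleR_left_commute)
qed simp

lemma convex_max_output_admissible:
  fixes M :: "real^'n^'n" and G :: "real^'m^'p"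
  assumes "convex Y"
  shows "convex (max_output_admissible lam M Bw C G Dw Y W)"
proof (rule convexI)
  fix p q :: "(real^'m) \<times> (real^'n)" and a b :: real
  assume pq: "p \<in> max_output_admissible lam M Bw C G Dw Y W"
      "q \<in> max_output_admissible lam M Bw C G Dw Y W"
    and ab: "0 \<le> a" "0 \<le> b" "a + b = 1"
  obtain v \<epsilon> v' \<epsilon>' where p: "p = (v, \<epsilon>)" and q: "q = (v', \<epsilon>')" by fastforce
  have "C *v error_seq lam M Bw \<omega> (a *\<^sub>R \<epsilon> + b *\<^sub>R \<epsilon>') t + G *v (a *\<^sub>R v + b *\<^sub>R v') + Dw *v \<omega> t \<in> Y"
    if "\<forall>t. \<omega> t \<in> W" for \<omega> t
  proof -
    let ?y = "\<lambda>v \<epsilon>. C *v error_seq lam M Bw \<omega> \<epsilon> t + G *v v + Dw *v \<omega> t"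
    have "a *\<^sub>R ?y v \<epsilon> + b *\<^sub>R ?y v' \<epsilon>' \<in> Y"
      using pq that ab \<open>convex Y\<close>
      by (auto simp: p q max_output_admissible_def intro!: convexD)
    moreover have b: "b = 1 - a" using ab by simp
    ultimately show ?thesis
      unfolding error_seq_convex[OF ab(3)]
      by (simp add: b matrix_vector_right_distrib matrix_vector_mult_scaleR
          algebra_simps)
  qed
  then show "a *\<^sub>R p + b *\<^sub>R q \<in> max_output_admissible lam M Bw C G Dw Y W"
    by (simp add: p q max_output_admissible_def)
qed

lemma continuous_on_matrix_vector_mult [continuous_intros]:
  fixes M :: "real^'n^'m"
  assumes "continuous_on S f"
  shows "continuous_on S (\<lambda>x. M *v f x)"
  using bounded_linear.continuous_on[OF matrix_vector_mul_bounded_linear assms] .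

lemma continuous_on_error_seq:
  "continuous_on UNIV (\<lambda>\<epsilon>. error_seq lam M Bw \<omega> \<epsilon> t)"
  by (induction t) (auto intro!: continuous_intros)

text \<open>An intersection of preimages of Y under continuous maps. Closedness is what makes the
  maximum in S2 attained.\<close>

lemma closed_max_output_admissible:
  assumes "closed Y"
  shows "closed (max_output_admissible lam M Bw C G Dw Y W)"
proof -
  have "max_output_admissible lam M Bw C G Dw Y W = (\<Inter>\<omega>\<in>{\<omega>. \<forall>t. \<omega> t \<in> W}. \<Inter>t.
      (\<lambda>p. C *v error_seq lam M Bw \<omega> (snd p) t + G *v fst p + Dw *v \<omega> t) -` Y)"
    by (auto simp: max_output_admissible_def)
  moreover have "closed ((\<lambda>p. C *v error_seq lam M Bw \<omega> (snd p) t + G *v fst p + Dw *v \<omega> t) -` Y)"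
    for \<omega> t
    by (intro closed_vimage assms continuous_intros
        continuous_on_compose2[OF continuous_on_error_seq]) auto
  ultimately show ?thesis by (auto intro!: closed_INT)
qed

lemma error_seq_shift:
  "error_seq lam M Bw \<omega> ((1 / lam) *\<^sub>R (M *v \<epsilon> + Bw *v \<omega>0)) t =
    error_seq lam M Bw (case_nat \<omega>0 \<omega>) \<epsilon> (Suc t)"
  by (induction t) simp_all

text \<open>Prepending \<open>\<omega>0\<close> to a disturbance sequence exhibits the new
  trajectory as the tail of an admissible one.\<close>

lemma max_output_admissible_step:
  assumes "(v, \<epsilon>) \<in> max_output_admissible lam M Bw C G Dw Y W" and "\<omega>0 \<in> W"
  shows "(v, (1 / lam) *\<^sub>R (M *v \<epsilon> + Bw *v \<omega>0)) \<in> max_output_admissible lam M Bw C G Dw Y W"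
  unfolding max_output_admissible_def
proof (clarify)
  fix \<omega> :: "nat \<Rightarrow> real^'c" and t assume "\<forall>t. \<omega> t \<in> W"
  with assms(2) have "\<forall>t. case_nat \<omega>0 \<omega> t \<in> W" by (simp split: nat.split)
  then have "C *v error_seq lam M Bw (case_nat \<omega>0 \<omega>) \<epsilon> (Suc t) + G *v v
      + Dw *v case_nat \<omega>0 \<omega> (Suc t) \<in> Y"
    using assms(1) unfolding max_output_admissible_def by blast
  then show "C *v error_seq lam M Bw \<omega> ((1 / lam) *\<^sub>R (M *v \<epsilon> + Bw *v \<omega>0)) t + G *v v
      + Dw *v \<omega> t \<in> Y"
    unfolding error_seq_shift by simp
qed

section \<open>Robust invariance and the tightened reference set\<close>

lemma error_seq_in_invariant:
  assumes "robust_pos_invariant lam M Bw W P" and "\<epsilon> \<in> P" and "\<And>t. \<omega> t \<in> W"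
  shows "error_seq lam M Bw \<omega> \<epsilon> t \<in> P"
proof (induction t)
  case (Suc t)
  then have "(1 / lam) *\<^sub>R (M *v error_seq lam M Bw \<omega> \<epsilon> t) + (1 / lam) *\<^sub>R (Bw *v \<omega> t) \<in> P"
    using assms(3)
    by (intro subsetD[OF assms(1)[unfolded robust_pos_invariant_def] set_plus_intro] imageI)
  then show ?case by (simp add: scaleR_right_distrib)
qed (use assms in simp)

text \<open>The zero disturbance produces the zero series. This puts 0 into P, so trajectories from
  zero error stay in P.\<close>

lemma zero_in_min_robust_invariant:
  assumes "0 \<in> W"
  shows "0 \<in> min_robust_invariant lam M Bw W"
proof -
  have "((\<lambda>\<epsilon>. (1 / lam) *\<^sub>R (M *v \<epsilon>)) ^^ i) 0 = 0" for i by (induction i) simp_all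
  with assms show ?thesis
    unfolding min_robust_invariant_def by (auto intro!: exI[of _ "\<lambda>_. 0"])
qed

text \<open>Superposition: the free response is controlled by the matrix power bound, the forced
  response by the invariant set.\<close>

lemma error_seq_split:
  "error_seq lam M Bw \<omega> \<epsilon> t = (1 / lam) ^ t *\<^sub>R ((*v) M ^^ t) \<epsilon> + error_seq lam M Bw \<omega> 0 t"
  by (induction t) (simp_all add: matrix_vector_right_distrib matrix_vector_mult_scaleR
    scaleR_right_distrib)

lemma tightened_reference_iff:
  "G *v v \<in> Ybar \<ominus> (*v) Dw ` W \<ominus> (*v) C ` P \<longleftrightarrow>
    (\<forall>\<epsilon>\<in>P. \<forall>\<omega>\<in>W. C *v \<epsilon> + G *v v + Dw *v \<omega> \<in> Ybar)"
  by (auto simp: pontryagin_diff_def add_ac)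

lemma convex_tightened_reference:
  fixes G :: "real^'m^'p"
  assumes "convex Ybar"
  shows "convex {v. G *v v \<in> Ybar \<ominus> (*v) Dw ` W \<ominus> (*v) C ` P}"
proof -
  have "{v. G *v v \<in> Ybar \<ominus> (*v) Dw ` W \<ominus> (*v) C ` P} =
      (\<Inter>\<epsilon>\<in>P. \<Inter>\<omega>\<in>W. (*v) G -` ((+) (- (C *v \<epsilon> + Dw *v \<omega>)) ` Ybar))"
    unfolding tightened_reference_iff by (auto simp: image_iff algebra_simps)
  then show ?thesis
    using assms by (auto intro!: convex_INT convex_linear_vimage convex_translation)
qed

lemma closed_tightened_reference:
  fixes G :: "real^'m^'p"
  assumes "closed Ybar"
  shows "closed {v. G *v v \<in> Ybar \<ominus> (*v) Dw ` W \<ominus> (*v) C ` P}"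
proof -
  have "{v. G *v v \<in> Ybar \<ominus> (*v) Dw ` W \<ominus> (*v) C ` P} =
      (\<Inter>\<epsilon>\<in>P. \<Inter>\<omega>\<in>W. (\<lambda>v. C *v \<epsilon> + G *v v + Dw *v \<omega>) -` Ybar)"
    unfolding tightened_reference_iff by auto
  moreover have "closed ((\<lambda>v. C *v \<epsilon> + G *v v + Dw *v \<omega>) -` Ybar)" for \<epsilon> \<omega>
    by (intro closed_vimage assms continuous_intros)
  ultimately show ?thesis by (auto intro!: closed_INT)
qed

lemma tightened_margin:
  fixes M :: "real^'n^'n" and Bw :: "real^'o^'n" and C :: "real^'n^'p" and G :: "real^'m^'p"
  assumes "spectral_radius M < lam"
    and inv: "robust_pos_invariant lam M Bw W P" and P: "0 \<in> P"
    and Ybar: "compact Ybar" "Ybar \<subseteq> interior Y"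
  obtains e where "e > 0"
    and "\<And>v \<epsilon>. G *v v \<in> Ybar \<ominus> (*v) Dw ` W \<ominus> (*v) C ` P \<Longrightarrow> norm \<epsilon> \<le> e \<Longrightarrow>
      (v, \<epsilon>) \<in> max_output_admissible lam M Bw C G Dw Y W"
proof -
  have lam: "lam > 0" using assms(1) spectral_radius_nonneg[of M] by linarith
  \<comment> \<open>Compactness of \<open>Ybar\<close> gives one margin for all its points.\<close>
  obtain \<eta> where \<eta>: "\<eta> > 0" "(\<Union>y\<in>Ybar. cball y \<eta>) \<subseteq> interior Y"
    using compact_subset_open_imp_cball_epsilon_subset[OF Ybar(1) open_interior Ybar(2)] .
  obtain c where c: "c > 0" "\<And>t q. norm (((*v) M ^^ t) q) \<le> c * lam ^ t * norm q"
    using matrix_power_bound[OF assms(1)] by blast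
  obtain k where k: "k > 0" "\<And>q. norm (C *v q) \<le> k * norm q"
    using linear_bounded_pos[OF matrix_vector_mul_linear] by blast
  \<comment> \<open>Chosen so that the output deviation, at most \<open>k * (c * e)\<close>, equals
    the margin.\<close>
  define e where "e = \<eta> / (k * c)"
  show thesis
  proof (rule that)
    show "e > 0" using \<eta> c k by (simp add: e_def)
    fix v and \<epsilon> :: "real^'n"
    assume v: "G *v v \<in> Ybar \<ominus> (*v) Dw ` W \<ominus> (*v) C ` P" and \<epsilon>: "norm \<epsilon> \<le> e"
    have "C *v error_seq lam M Bw \<omega> \<epsilon> t + G *v v + Dw *v \<omega> t \<in> Y" if \<omega>: "\<forall>t. \<omega> t \<in> W" for \<omega> t
    proof -
      let ?y = "C *v error_seq lam M Bw \<omega> 0 t + G *v v + Dw *v \<omega> t"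
      let ?d = "(1 / lam) ^ t *\<^sub>R ((*v) M ^^ t) \<epsilon>"
      have y: "?y \<in> Ybar"
        using v \<omega> error_seq_in_invariant[OF inv P] unfolding tightened_reference_iff by blast
      \<comment> \<open>The inflation \<open>(1 / lam) ^ t\<close> cancels the decay
        \<open>lam ^ t\<close>, so the bound is uniform in t.\<close>
      have "norm ?d \<le> (1 / lam) ^ t * (c * lam ^ t * norm \<epsilon>)"
        using c(2)[of t \<epsilon>] lam by (simp add: mult_left_mono)
      also have "\<dots> = c * norm \<epsilon>" using lam by (simp add: power_divide)
      finally have "norm ?d \<le> c * e" using \<epsilon> c(1) by (meson mult_left_mono less_imp_le order_trans)
      then have "norm (C *v ?d) \<le> k * (c * e)"
        using k by (meson mult_left_mono less_imp_le order_trans)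
      then have "norm (C *v ?d) \<le> \<eta>" using k c by (simp add: e_def)
      then have "?y + C *v ?d \<in> cball ?y \<eta>" by (simp add: dist_norm)
      then have "?y + C *v ?d \<in> Y" using y \<eta>(2) interior_subset by blast
      moreover have "C *v error_seq lam M Bw \<omega> \<epsilon> t = C *v ?d + C *v error_seq lam M Bw \<omega> 0 t"
        by (subst error_seq_split) (rule matrix_vector_right_distrib)
      ultimately show ?thesis by (simp add: add_ac)
    qed
    then show "(v, \<epsilon>) \<in> max_output_admissible lam M Bw C G Dw Y W"
      by (simp add: max_output_admissible_def)
  qed
qed

text \<open>At the midpoint, strong convexity forces a drop quadratic in the distance below the
  average of the end values, while the Lipschitz bound allows only a linear one.\<close>

lemma strongly_convex_lipschitz_dist_le:
  assumes "strongly_convex_on S \<mu> f" "k-lipschitz_on S f" "convex S" "\<mu> > 0" "a \<in> S" "b \<in> S"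
  shows "norm (a - b) \<le> 4 * k / \<mu>"
proof (cases "a = b")
  case True
  with assms lipschitz_on_nonneg show ?thesis by fastforce
next
  case False
  define d where "d = norm (a - b)"
  define m where "m = (1/2) *\<^sub>R a + (1 - 1/2) *\<^sub>R b"
  have "m \<in> S" using assms unfolding m_def by (intro convexD) auto
  have *: "f m \<le> 1/2 * f a + (1 - 1/2) * f b - \<mu> / 2 * (1/2) * (1 - 1/2) * d\<^sup>2"
    using assms(1)[unfolded strongly_convex_on_def, rule_format, of a b "1/2"] assms(5,6)
    unfolding m_def d_def by simp
  have "a - m = (1/2) *\<^sub>R (a - b)" "b - m = - ((1/2) *\<^sub>R (a - b))"
    by (simp_all add: m_def algebra_simps flip: scaleR_left_distrib)
  then have dist: "dist a m = d / 2" "dist b m = d / 2"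
    by (simp_all add: dist_norm d_def)
  have "f a - f m \<le> k * (d / 2)" "f b - f m \<le> k * (d / 2)"
    using lipschitz_onD[OF assms(2) \<open>a \<in> S\<close> \<open>m \<in> S\<close>] lipschitz_onD[OF assms(2) \<open>b \<in> S\<close> \<open>m \<in> S\<close>]
    unfolding dist dist_real_def by linarith+
  with * have "\<mu> / 8 * d\<^sup>2 \<le> k * (d / 2)" by simp
  then have "d * (\<mu> * d) \<le> d * (4 * k)" by (simp add: power2_eq_square algebra_simps)
  moreover have "d > 0" using False by (simp add: d_def)
  ultimately have "\<mu> * d \<le> 4 * k" by simp
  then show ?thesis using \<open>\<mu> > 0\<close> by (simp add: d_def pos_le_divide_eq mult.commute)
qed

text \<open>\<open>GREATEST\<close> denotes a maximum only if one exists; compactness supplies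
  it.\<close>

lemma Greatest_compact:
  fixes F :: "real set"
  assumes "compact F" "F \<noteq> {}"
  shows "(GREATEST a. a \<in> F) \<in> F" and "\<And>b. b \<in> F \<Longrightarrow> b \<le> (GREATEST a. a \<in> F)"
proof -
  obtain s where s: "s \<in> F" "\<forall>b\<in>F. b \<le> s" using compact_attains_sup[OF assms] by blast
  then have "(GREATEST a. a \<in> F) = s" by (intro Greatest_equality) auto
  with s show "(GREATEST a. a \<in> F) \<in> F" "\<And>b. b \<in> F \<Longrightarrow> b \<le> (GREATEST a. a \<in> F)" by auto
qed

text \<open>A nonzero kernel vector would be an eigenvector for the eigenvalue 1.\<close>

lemma invertible_one_minus_schur_stable:
  fixes M :: "real^'n^'n"
  assumes "schur_stable M"
  shows "invertible (mat 1 - M)"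
proof -
  have "q = 0" if "(mat 1 - M) *v q = 0" for q
  proof (rule ccontr)
    assume "q \<noteq> 0"
    let ?q = "\<chi> i. complex_of_real (q $ i)"
    have "M *v q = q" using that by (simp add: matrix_vector_mult_diff_rdistrib)
    then have "complexify M *v ?q = 1 *s ?q" by (simp add: complexify_mult_vec)
    moreover have "?q \<noteq> 0" using \<open>q \<noteq> 0\<close> by (simp add: vec_eq_iff)
    ultimately have "1 \<in> eigenvalues M" unfolding eigenvalues_complexify by blast
    then show False using cmod_le_spectral_radius[of 1 M] assms by (simp add: schur_stable_def)
  qed
  then have "\<exists>N. N ** (mat 1 - M) = mat 1"
    unfolding matrix_left_invertible_ker by blast
  then show ?thesis using invertible_left_inverse by blast
qed

subsection \<open>The step sizes of the scheme\<close>

theorem lemma2: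
  fixes A :: "real^'n^'n" and B :: "real^'m^'n" and Bw :: "real^'o^'n"
    and Co :: "real^'n^'p" and D :: "real^'m^'p" and Dw :: "real^'o^'p"
    and K :: "real^'n^'m"
    and Y Ybar :: "(real^'p) set" and W :: "(real^'o) set" and P :: "(real^'n) set"
    and L :: "nat \<Rightarrow> (real^'m) \<times> (real^'n) \<Rightarrow> real"
    and lam lL \<alpha>v lv \<gamma> :: real
    and x0 :: "real^'n" and r0 :: "real^'m"
    and w :: "nat \<Rightarrow> real^'o" and x :: "nat \<Rightarrow> real^'n"
    and u v r :: "nat \<Rightarrow> real^'m" and \<alpha> :: "nat \<Rightarrow> real"
  defines "AK \<equiv> A + B ** K"
    and "C \<equiv> Co + D ** K"
  defines "SK \<equiv> matrix_inv (mat 1 - AK) ** B"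
  defines "G \<equiv> C ** SK + D"
  defines "Sv \<equiv> {v. G *v v \<in> Y \<ominus> (*v) Dw ` W}"
    and "Svbar \<equiv> {v. G *v v \<in> Ybar \<ominus> (*v) Dw ` W \<ominus> (*v) C ` P}"
    and "Z \<equiv> {(u, x). Co *v x + D *v u \<in> Y}"
    and "Ls \<equiv> \<lambda>t. steady_state_cost K SK (L t)"
    and "Oinf \<equiv> max_output_admissible lam AK Bw C G Dw Y W"
  assumes "stabilizable A B" and "schur_stable AK"
    and "compact Y" and "convex Y" and "0 \<in> interior Y"
    and "compact W" and "convex W" and "0 \<in> interior W" and "\<forall>t. w t \<in> W"
    and "lL > 0" and "\<alpha>v > 0" and "lv > 0"
    and "\<forall>t. lL-lipschitz_on Z (L t)"
    and "\<forall>t. strongly_convex_on Sv \<alpha>v (Ls t)"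
    and "\<forall>t. lipschitz_gradient_on Sv lv (Ls t)"
    and "spectral_radius AK < lam" and "lam < 1"
    and "robust_pos_invariant lam AK Bw W P"
    and "min_robust_invariant lam AK Bw W \<subseteq> P"
    and "convex Ybar" and "compact Ybar" and "0 \<in> Ybar" and "Ybar \<subseteq> interior Y"
    and "r0 \<in> Svbar" and "(r0, x0 - SK *v r0) \<in> Oinf"
    and "\<gamma> \<in> {0<..2 / (\<alpha>v + lv)}"
    and "x 0 = x0" and "\<forall>t. x (Suc t) = A *v x t + B *v u t + Bw *v w t"
    and "oco_rg_scheme \<gamma> Ls Svbar Oinf SK K r0 x r \<alpha> v u"
  shows "\<exists>\<delta>\<in>{0<..1}. \<forall>t. \<delta> \<le> \<alpha> t"
proof -
  note asm = \<open>schur_stable AK\<close> \<open>spectral_radius AK < lam\<close> \<open>lam < 1\<close>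
  have lam: "0 < lam" using asm(2) spectral_radius_nonneg[of AK] by linarith
  have W: "0 \<in> W" using \<open>0 \<in> interior W\<close> interior_subset by blast
  have P: "0 \<in> P"
    using \<open>min_robust_invariant lam AK Bw W \<subseteq> P\<close> zero_in_min_robust_invariant[OF W] by blast
  \<comment> \<open>The steady state of v is a fixed point of the undisturbed dynamics. As
    \<open>matrix_inv\<close> is a choice, invertibility must come first.\<close>
  have SK: "AK *v (SK *v q) + B *v q = SK *v q" for q
  proof -
    have "(mat 1 - AK) ** SK = B"
      using someI_ex[OF invertible_one_minus_schur_stable[OF asm(1), unfolded invertible_def]]
      by (simp add: SK_def matrix_inv_def matrix_mul_assoc)
    then have "(mat 1 - AK) *v (SK *v q) = B *v q" by (simp add: matrix_vector_mul_assoc)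
    then show ?thesis by (simp add: matrix_vector_mult_diff_rdistrib algebra_simps)
  qed
  have convex_Svbar: "convex Svbar"
    unfolding Svbar_def by (rule convex_tightened_reference[OF \<open>convex Ybar\<close>])
  have closed_Svbar: "closed Svbar"
    unfolding Svbar_def
    by (rule closed_tightened_reference[OF compact_imp_closed[OF \<open>compact Ybar\<close>]])
  have convex_Oinf: "convex Oinf"
    unfolding Oinf_def by (rule convex_max_output_admissible[OF \<open>convex Y\<close>])
  have closed_Oinf: "closed Oinf"
    unfolding Oinf_def
    by (rule closed_max_output_admissible[OF compact_imp_closed[OF \<open>compact Y\<close>]])
  have "Svbar \<subseteq> Sv"
  proof
    fix q assume "q \<in> Svbar"
    then have "C *v 0 + G *v q + Dw *v \<omega> \<in> Ybar" if "\<omega> \<in> W" for \<omega>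
      using P that unfolding Svbar_def tightened_reference_iff mem_Collect_eq by blast
    then have "G *v q + Dw *v \<omega> \<in> Y" if "\<omega> \<in> W" for \<omega>
      using that \<open>Ybar \<subseteq> interior Y\<close> interior_subset by fastforce
    then show "q \<in> Sv" by (simp add: Sv_def pontryagin_diff_def)
  qed
  \<comment> \<open>Compactness of Y bounds only \<open>G *v v\<close>, not v itself; the diameter
    bound comes from the cost at time 0.\<close>
  obtain R where R: "R > 0" "\<And>a b. a \<in> Svbar \<Longrightarrow> b \<in> Svbar \<Longrightarrow> norm (SK *v (a - b)) \<le> R"
  proof -
    let ?h = "\<lambda>q. (q + K *v (SK *v q), SK *v q)"
    have "linear ?h"
      by (rule linearI) (simp_all add: matrix_vector_right_distrib matrix_vector_mult_scaleR
          scaleR_right_distrib)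
    then obtain k where k: "k > 0" "\<And>q. norm (?h q) \<le> k * norm q"
      using linear_bounded_pos by blast
    \<comment> \<open>Zero disturbance turns membership in \<open>Sv\<close> into feasibility of the
      steady-state pair, where the Lipschitz hypothesis applies.\<close>
    have h: "?h q \<in> Z" if "q \<in> Svbar" for q
    proof -
      have "G *v q + Dw *v 0 \<in> Y"
        using that \<open>Svbar \<subseteq> Sv\<close> W unfolding Sv_def pontryagin_diff_def by blast
      then show ?thesis
        by (simp add: Z_def G_def C_def matrix_vector_mult_add_rdistrib matrix_vector_right_distrib
            matrix_vector_mul_assoc[symmetric] add_ac)
    qed
    have lip: "(lL * k)-lipschitz_on Svbar (Ls 0)"
    proof (rule lipschitz_onI)
      fix a b assume ab: "a \<in> Svbar" "b \<in> Svbar"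
      have "dist (Ls 0 a) (Ls 0 b) \<le> lL * dist (?h a) (?h b)"
        using lipschitz_onD[of lL Z "L 0" "?h a" "?h b"] \<open>\<forall>t. lL-lipschitz_on Z (L t)\<close> h ab
        by (simp add: Ls_def steady_state_cost_def)
      also have "dist (?h a) (?h b) \<le> k * dist a b"
        using k(2)[of "a - b"] linear_diff[OF \<open>linear ?h\<close>, of a b] by (simp add: dist_norm)
      finally show "dist (Ls 0 a) (Ls 0 b) \<le> lL * k * dist a b"
        using \<open>lL > 0\<close> by (simp add: mult_ac)
    qed (use \<open>lL > 0\<close> k in simp)
    have "strongly_convex_on Svbar \<alpha>v (Ls 0)"
      using \<open>\<forall>t. strongly_convex_on Sv \<alpha>v (Ls t)\<close> \<open>Svbar \<subseteq> Sv\<close>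
      unfolding strongly_convex_on_def by blast
    note diam = strongly_convex_lipschitz_dist_le[OF this lip convex_Svbar \<open>\<alpha>v > 0\<close>]
    obtain s where s: "s > 0" "\<And>q. norm (SK *v q) \<le> s * norm q"
      using linear_bounded_pos[OF matrix_vector_mul_linear] by blast
    show thesis
    proof (rule that)
      show "s * (4 * (lL * k) / \<alpha>v) > 0" using s k \<open>lL > 0\<close> \<open>\<alpha>v > 0\<close> by simp
      show "norm (SK *v (a - b)) \<le> s * (4 * (lL * k) / \<alpha>v)" if "a \<in> Svbar" "b \<in> Svbar" for a b
        using s(2)[of "a - b"] mult_left_mono[OF diam[OF that], of s] s(1) by linarith
    qed
  qed
  obtain e where e: "e > 0"
    "\<And>q \<epsilon>. q \<in> Svbar \<Longrightarrow> norm \<epsilon> \<le> e \<Longrightarrow> (q, \<epsilon>) \<in> Oinf"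
    using tightened_margin[OF asm(2) \<open>robust_pos_invariant lam AK Bw W P\<close> P
        \<open>compact Ybar\<close> \<open>Ybar \<subseteq> interior Y\<close>, where C = C and G = G and Dw = Dw]
    unfolding Svbar_def Oinf_def mem_Collect_eq by blast
  \<comment> \<open>Keeps the steady-state displacement within the margin e, and at most 1 so that
    \<open>Svbar\<close> is not left.\<close>
  define s where "s = min 1 (e / R)"
  have s: "0 < s" "s \<le> 1" "s * R \<le> e"
    using e(1) R(1) by (auto simp: s_def min_def field_simps)
  define \<delta> where "\<delta> = (1 - lam) * s"
  have \<delta>: "0 < \<delta>" "\<delta> \<le> 1"
    using s lam asm(3) by (auto simp: \<delta>_def intro: mult_le_one)
  have step: "(q + \<delta> *\<^sub>R (p - q), AK *v \<epsilon> + Bw *v \<omega> - \<delta> *\<^sub>R (SK *v (p - q))) \<in> Oinf"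
    if "q \<in> Svbar" "p \<in> Svbar" "(q, \<epsilon>) \<in> Oinf" "\<omega> \<in> W" for q p \<epsilon> \<omega>
  proof -
    let ?\<epsilon> = "AK *v \<epsilon> + Bw *v \<omega>"
    let ?d = "- s *\<^sub>R (SK *v (p - q))"
    have 1: "(q, (1 / lam) *\<^sub>R ?\<epsilon>) \<in> Oinf"
      using max_output_admissible_step that(3,4) unfolding Oinf_def by blast
    have "(1 - s) *\<^sub>R q + s *\<^sub>R p \<in> Svbar"
      using convexD_alt[OF convex_Svbar that(1,2)] s by simp
    moreover have "norm ?d = s * norm (SK *v (p - q))" using s(1) by simp
    then have "norm ?d \<le> e"
      using mult_left_mono[OF R(2)[OF that(2,1)], of s] s by linarith
    ultimately have 2: "((1 - s) *\<^sub>R q + s *\<^sub>R p, ?d) \<in> Oinf" by (rule e(2))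
    have "lam *\<^sub>R (q, (1 / lam) *\<^sub>R ?\<epsilon>) + (1 - lam) *\<^sub>R ((1 - s) *\<^sub>R q + s *\<^sub>R p, ?d) \<in> Oinf"
      using lam asm(3) by (intro convexD[OF convex_Oinf 1 2]) auto
    moreover have "lam *\<^sub>R q + (1 - lam) *\<^sub>R ((1 - s) *\<^sub>R q + s *\<^sub>R p) = q + \<delta> *\<^sub>R (p - q)"
      by (simp add: \<delta>_def algebra_simps)
    moreover have "lam *\<^sub>R (1 / lam) *\<^sub>R ?\<epsilon> + (1 - lam) *\<^sub>R ?d = ?\<epsilon> - \<delta> *\<^sub>R (SK *v (p - q))"
      using lam by (simp add: \<delta>_def)
    ultimately show ?thesis by simp
  qed
  from \<open>oco_rg_scheme \<gamma> Ls Svbar Oinf SK K r0 x r \<alpha> v u\<close>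
  have init: "r 0 = r0" "\<alpha> 0 = 1" "v 0 = r0"
    and r_Suc: "\<And>t. r (Suc t) = closest_point Svbar (r t - \<gamma> *\<^sub>R gradient (Ls t) (r t))"
    and \<alpha>_Suc: "\<And>t. \<alpha> (Suc t) = (GREATEST a. a \<in> {0..1} \<and>
        (let v' = v t + a *\<^sub>R (r (Suc t) - v t) in (v', x (Suc t) - SK *v v') \<in> Oinf))"
    and v_Suc: "\<And>t. v (Suc t) = v t + \<alpha> (Suc t) *\<^sub>R (r (Suc t) - v t)"
    and u: "\<And>t. u t = v t + K *v x t"
    unfolding oco_rg_scheme_def by blast+
  \<comment> \<open>The first two conjuncts strengthen the induction: they are what
    \<open>step\<close> requires of the current reference and error.\<close>
  have "v t \<in> Svbar \<and> (v t, x t - SK *v v t) \<in> Oinf \<and> \<delta> \<le> \<alpha> t" for t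
  proof (induction t)
    case 0
    show ?case
      using init \<delta> \<open>x 0 = x0\<close> \<open>r0 \<in> Svbar\<close> \<open>(r0, x0 - SK *v r0) \<in> Oinf\<close> by simp
  next
    case (Suc t)
    then have vt: "v t \<in> Svbar" and adm: "(v t, x t - SK *v v t) \<in> Oinf" by auto
    have r: "r (Suc t) \<in> Svbar"
      unfolding r_Suc using closed_Svbar \<open>r0 \<in> Svbar\<close> by (intro closest_point_in_set) auto
    let ?v = "\<lambda>a. v t + a *\<^sub>R (r (Suc t) - v t)"
    \<comment> \<open>The feasible step sizes in S2: a compact set that will be shown to contain
      \<open>\<delta>\<close>, so its maximum is at least \<open>\<delta>\<close>.\<close>
    define F where "F = {a \<in> {0..1}. (?v a, x (Suc t) - SK *v ?v a) \<in> Oinf}"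
    have "F = {0..1} \<inter> (\<lambda>a. (?v a, x (Suc t) - SK *v ?v a)) -` Oinf" by (auto simp: F_def)
    moreover have "closed ((\<lambda>a. (?v a, x (Suc t) - SK *v ?v a)) -` Oinf)"
      by (intro closed_vimage closed_Oinf continuous_intros)
    ultimately have "compact F" by (auto intro: compact_Int_closed)
    have "x (Suc t) = A *v x t + B *v u t + Bw *v w t"
      using \<open>\<forall>t. x (Suc t) = A *v x t + B *v u t + Bw *v w t\<close> by blast
    also have "\<dots> = AK *v x t + B *v v t + Bw *v w t"
      by (simp add: u AK_def matrix_vector_mult_add_rdistrib matrix_vector_right_distrib
          matrix_vector_mul_assoc[symmetric])
    \<comment> \<open>Subtracting the fixed-point identity for \<open>v t\<close> gives the error
      dynamics with the old reference, before the step is taken.\<close>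
    finally have "x (Suc t) - SK *v v t = AK *v (x t - SK *v v t) + Bw *v w t"
      using SK[of "v t"] by (simp add: matrix_vector_mult_diff_distrib algebra_simps)
    then have "x (Suc t) - SK *v ?v \<delta> =
        AK *v (x t - SK *v v t) + Bw *v w t - \<delta> *\<^sub>R (SK *v (r (Suc t) - v t))"
      by (simp add: matrix_vector_right_distrib matrix_vector_mult_scaleR diff_diff_eq[symmetric])
    with step[OF vt r adm] \<open>\<forall>t. w t \<in> W\<close> have "\<delta> \<in> F"
      using \<delta> by (simp add: F_def)
    then have "F \<noteq> {}" by blast
    have \<alpha>: "\<alpha> (Suc t) = (GREATEST a. a \<in> F)"
      unfolding \<alpha>_Suc F_def by (simp add: Let_def)
    have "\<alpha> (Suc t) \<in> F" "\<delta> \<le> \<alpha> (Suc t)"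
      using Greatest_compact[OF \<open>compact F\<close> \<open>F \<noteq> {}\<close>] \<open>\<delta> \<in> F\<close> unfolding \<alpha> by auto
    moreover have "?v (\<alpha> (Suc t)) = (1 - \<alpha> (Suc t)) *\<^sub>R v t + \<alpha> (Suc t) *\<^sub>R r (Suc t)"
      by (simp add: algebra_simps)
    then have "v (Suc t) \<in> Svbar"
      using convexD_alt[OF convex_Svbar vt r] \<open>\<alpha> (Suc t) \<in> F\<close> by (simp add: v_Suc F_def)
    ultimately show ?case by (simp add: v_Suc F_def)
  qed
  then show ?thesis using \<delta> by (intro bexI[of _ \<delta>]) auto
qed

end
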